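(* Socle length $\mathbf{sx}$ does not satisfy the extension axiom: there exist a finite group $G$ and a normal subgroup $N\lhd G$ with $\mathbf{sx}(G)>\mathbf{sx}(N)+\mathbf{sx}(G/N)$. Hence $\mathbf{cx}\ne\mathbf{sx}$ as functions on finite groups.
   Context: All groups are finite. Functions $\mathbf{c}$ go from the class of finite groups to $\mathbb{N}=\{0,1,2,\dots\}$. The complexity axioms for $\mathbf{c}$ are the following five. (Extension) If $N\lhd G$, then $\mathbf{c}(G)\le \mathbf{c}(N)+\mathbf{c}(G/N)$. (Quotient) If there is a surjective homomorphism $G\to H$, then $\mathbf{c}(G)\ge \mathbf{c}(H)$. (Constructability) Every group $G$ has a subnormal series $\mathbf{1}=G_n\lhd G_{n-1}\lhd\cdots\lhd G_0=G$ (some $n\ge 0$) with $\mathbf{c}(G_i/G_{i+1})\le 1$ for all $0\le i<n$. (Product) If $G=H\times K$, then $\mathbf{c}(G)=\max(\mathbf{c}(H),\mathbf{c}(K))$. (Initial condition) $\mathbf{c}(\mathbf{1})=0$ for the trivial group $\mathbf{1}$. A complexity function is a function satisfying these five axioms. $\mathbf{cx}$ denotes the unique maximal (pointwise largest) complexity function on finite groups, $\mathbf{cx}(G)=\sup\{\mathbf{c}(G):\mathbf{c}\text{ a complexity function}\}$. The socle $\mathrm{soc}(G)$ is the subgroup generated by the minimal normal subgroups of $G$. The socle series is $V_0=\mathbf{1}$ and $V_{i+1}$ = the preimage of $\mathrm{soc}(G/V_i)$ under the quotient map $G\to G/V_i$; the socle length $\mathbf{sx}(G)$ is the least $\ell\ge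 0$ with $V_\ell=G$. *)

theory Defs
  imports "HOL-Algebra.Coset" "HOL-Algebra.Generated_Groups" "HOL-Algebra.Elementary_Groups"
begin

definition minimal_normal :: "('a, 'b) monoid_scheme \<Rightarrow> 'a set \<Rightarrow> bool" where
  "minimal_normal G M \<longleftrightarrow>
     M \<lhd> G \<and> M \<noteq> {\<one>\<^bsub>G\<^esub>} \<and> (\<forall>K. K \<lhd> G \<and> K \<subseteq> M \<longrightarrow> K = {\<one>\<^bsub>G\<^esub>} \<or> K = M)"

definition socle :: "('a, 'b) monoid_scheme \<Rightarrow> 'a set" where
  "socle G = generate G (\<Union>{M. minimal_normal G M})"

primrec socle_series :: "('a, 'b) monoid_scheme \<Rightarrow> nat \<Rightarrow> 'a set" where
  "socle_series G 0 = {\<one>\<^bsub>G\<^esub>}"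
| "socle_series G (Suc i) =
     {x \<in> carrier G. socle_series G i #>\<^bsub>G\<^esub> x \<in> socle (G Mod socle_series G i)}"

definition sx :: "('a, 'b) monoid_scheme \<Rightarrow> nat" where
  "sx G = (LEAST l. socle_series G l = carrier G)"

text \<open>
  The class of finite groups is represented by the finite groups with carrier in \<^typ>\<open>nat\<close>: up to
  isomorphism these are all finite groups. Groups such as quotients and direct products, which live
  on another type, enter the axioms through their isomorphic copies on \<^typ>\<open>nat\<close>. The choice of
  the copy is immaterial for a function satisfying the quotient axiom, since that axiom makes it
  invariant under isomorphism.
\<close>

definition finite_group :: "('a, 'b) monoid_scheme \<Rightarrow> bool" where
  "finite_group G \<longleftrightarrow> group G \<and> finite (carrier G)"

definition extension_axiom :: "(nat monoid \<Rightarrow> nat) \<Rightarrow> bool" where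
  "extension_axiom c \<longleftrightarrow>
     (\<forall>G N Q. finite_group G \<and> N \<lhd> G \<and> finite_group Q \<and> Q \<cong> G Mod N \<longrightarrow>
        c G \<le> c (G\<lparr>carrier := N\<rparr>) + c Q)"

definition quotient_axiom :: "(nat monoid \<Rightarrow> nat) \<Rightarrow> bool" where
  "quotient_axiom c \<longleftrightarrow>
     (\<forall>G H. finite_group G \<and> finite_group H \<and> epi G H \<noteq> {} \<longrightarrow> c H \<le> c G)"

definition constructability_axiom :: "(nat monoid \<Rightarrow> nat) \<Rightarrow> bool" where
  "constructability_axiom c \<longleftrightarrow>
     (\<forall>G :: nat monoid. finite_group G \<longrightarrow>
        (\<exists>n (S :: nat \<Rightarrow> nat set). S 0 = carrier G \<and> S n = {\<one>\<^bsub>G\<^esub>} \<and>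
           (\<forall>i<n. S (Suc i) \<lhd> G\<lparr>carrier := S i\<rparr> \<and>
              (\<exists>Q. finite_group Q \<and> Q \<cong> G\<lparr>carrier := S i\<rparr> Mod S (Suc i) \<and> c Q \<le> 1))))"

definition product_axiom :: "(nat monoid \<Rightarrow> nat) \<Rightarrow> bool" where
  "product_axiom c \<longleftrightarrow>
     (\<forall>G H K. finite_group G \<and> finite_group H \<and> finite_group K \<and> G \<cong> H \<times>\<times> K \<longrightarrow>
        c G = max (c H) (c K))"

definition initial_condition :: "(nat monoid \<Rightarrow> nat) \<Rightarrow> bool" where
  "initial_condition c \<longleftrightarrow> (\<forall>G. trivial_group G \<longrightarrow> c G = 0)"

definition complexity_function :: "(nat monoid \<Rightarrow> nat) \<Rightarrow> bool" where
  "complexity_function c \<longleftrightarrow>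
     extension_axiom c \<and> quotient_axiom c \<and> constructability_axiom c \<and>
     product_axiom c \<and> initial_condition c"

text \<open>
  For a finite group \<open>G\<close> the supremum is a genuine maximum. The set is nonempty, because the
  function that is 0 on trivial groups and 1 elsewhere is a complexity function. It is bounded,
  because the extension axiom along a series as in the constructability axiom, with repetitions
  deleted, bounds the value at \<open>G\<close> by the largest length of a strictly decreasing subnormal series
  of \<open>G\<close>. On records that are not finite groups the value is meaningless.
\<close>

definition cx :: "nat monoid \<Rightarrow> nat" where
  "cx G = Sup {c G | c. complexity_function c}"

end

theory Submission
  imports Defs "HOL-Library.Z2"
begin

text \<open>
  Let \<open>G\<close> be the group of unitriangular 4 by 4 matrices over the field with two elements, and \<open>N\<close>
  the subgroup of those whose two diagonal 2 by 2 blocks are trivial. Both \<open>N\<close> and \<open>G/N\<close> are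
  elementary abelian, hence of socle length 1. In a nilpotent group every minimal normal subgroup is
  central, so the socle series is a central series and its length is at least the nilpotency class,
  which is 3 for \<open>G\<close>.

  A complexity function is at most 1 on the group of order 2 by constructability, hence at most 1 on
  \<open>N\<close> and \<open>G/N\<close> by the product axiom, hence at most 2 on \<open>G\<close> by the extension axiom. So
  \<open>cx G \<le> 2\<close>; this does not depend on the existence of complexity functions, as the
  supremum of the empty set of natural numbers is 0.
\<close>

section \<open>The socle series\<close>

lemma (in group) normal_socle: "socle G \<lhd> G"
  unfolding socle_def
proof (rule normal_generateI)
  show "\<Union>{M. minimal_normal G M} \<subseteq> carrier G"
    by (auto simp: minimal_normal_def dest!: normal_imp_subgroup intro: subgroup.mem_carrier)
next
  fix h g assume "h \<in> \<Union>{M. minimal_normal G M}" "g \<in> carrier G"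
  then show "g \<otimes> h \<otimes> inv g \<in> \<Union>{M. minimal_normal G M}"
    by (auto simp: minimal_normal_def normal_inv_iff)
qed

text \<open>The next term is the union of the cosets lying in the socle of the quotient. Normality
  of the socle there lifts to \<open>G\<close> by the correspondence of normal subgroups.\<close>

lemma (in group) normal_socle_series: "socle_series G i \<lhd> G"
proof (induction i)
  case 0
  show ?case by (simp add: one_is_normal)
next
  case (Suc i)
  interpret V: normal "socle_series G i" G by (rule Suc)
  interpret Q: group "G Mod socle_series G i" by (rule V.factorgroup_is_group)
  have "socle_series G (Suc i) = \<Union>(socle (G Mod socle_series G i))"
    using V.factgroup_subgroup_union_char[OF normal_imp_subgroup[OF Q.normal_socle]] by simp
  then show ?case
    using V.factgroup_subgroup_union_normal[OF Q.normal_socle] by simp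
qed

lemma (in group) exists_minimal_normal:
  assumes "finite (carrier G)" "carrier G \<noteq> {\<one>}"
  shows "\<exists>M. minimal_normal G M"
proof -
  let ?A = "{M. M \<lhd> G \<and> M \<noteq> {\<one>}}"
  have "?A \<subseteq> Pow (carrier G)"
    by (auto dest!: normal_imp_subgroup intro: subgroup.mem_carrier)
  then have "finite ?A" using assms(1) by (meson finite_Pow_iff finite_subset)
  moreover have "?A \<noteq> {}" using assms(2) normal_self by blast
  ultimately obtain M where "M \<in> ?A" "\<forall>K\<in>?A. K \<subseteq> M \<longrightarrow> K = M"
    using finite_has_minimal by (metis (no_types, lifting))
  then show ?thesis unfolding minimal_normal_def by blast
qed

lemma (in group) socle_nontrivial:
  assumes "finite (carrier G)" "carrier G \<noteq> {\<one>}"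
  shows "socle G \<noteq> {\<one>}"
proof -
  obtain M where M: "minimal_normal G M" using exists_minimal_normal[OF assms] ..
  then obtain x where "x \<in> M" "x \<noteq> \<one>"
    by (metis minimal_normal_def normal_imp_subgroup subgroup.one_closed subsetI subset_antisym
        insert_subset empty_subsetI singletonI)
  then have "x \<in> socle G" unfolding socle_def using M by (intro generate.incl) auto
  with \<open>x \<noteq> \<one>\<close> show ?thesis by auto
qed

text \<open>As long as the series has not reached \<open>G\<close>, the quotient is a nontrivial
  finite group. Its socle then contains a nontrivial coset, whose representatives are new
  elements.\<close>

lemma (in group) socle_series_strict:
  assumes fin: "finite (carrier G)" and ne: "socle_series G i \<noteq> carrier G"
  shows "socle_series G i \<subset> socle_series G (Suc i)"
proof -
  let ?V = "socle_series G i"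
  interpret V: normal ?V G by (rule normal_socle_series)
  interpret Q: group "G Mod ?V" by (rule V.factorgroup_is_group)
  have "finite (carrier (G Mod ?V))" using fin by (simp add: carrier_FactGroup)
  moreover have "carrier (G Mod ?V) \<noteq> {\<one>\<^bsub>G Mod ?V\<^esub>}"
    using V.fact_group_trivial_iff[OF fin] ne by simp
  ultimately have "socle (G Mod ?V) \<noteq> {?V}" using Q.socle_nontrivial by simp
  moreover have one: "?V \<in> socle (G Mod ?V)"
    using subgroup.one_closed[OF normal_imp_subgroup[OF Q.normal_socle]] by simp
  ultimately obtain X where X: "X \<in> socle (G Mod ?V)" "X \<noteq> ?V" by auto
  then have "X \<in> carrier (G Mod ?V)"
    using normal_imp_subgroup[OF Q.normal_socle] subgroup.mem_carrier by fastforce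
  then obtain x where x: "x \<in> carrier G" "X = ?V #> x" by (auto simp: carrier_FactGroup)
  then have "x \<in> socle_series G (Suc i)" "x \<notin> ?V"
    using X V.rcos_const[OF is_group] by auto
  moreover have "?V \<subseteq> socle_series G (Suc i)"
    using V.rcos_const[OF is_group] one V.mem_carrier by auto
  ultimately show ?thesis by blast
qed

text \<open>The \<open>LEAST\<close> in the definition of \<open>sx\<close> carries information only
  once some term is known to equal \<open>G\<close>; finiteness provides one.\<close>

lemma (in group) socle_series_sx:
  assumes fin: "finite (carrier G)"
  shows "socle_series G (sx G) = carrier G"
proof -
  have "\<exists>l. socle_series G l = carrier G"
  proof (rule ccontr)
    assume ne: "\<nexists>l. socle_series G l = carrier G"
    have sub: "socle_series G i \<subseteq> carrier G" for i
      using normal_imp_subgroup[OF normal_socle_series] subgroup.subset by blast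
    \<comment> \<open>A series that never reaches \<open>G\<close> grows by at least one element per
      step, which eventually exceeds the order of \<open>G\<close>.\<close>
    have "i \<le> card (socle_series G i)" for i
    proof (induction i)
      case (Suc i)
      have "card (socle_series G i) < card (socle_series G (Suc i))"
        using socle_series_strict[OF fin] ne finite_subset[OF sub fin] by (meson psubset_card_mono)
      then show ?case using Suc by simp
    qed simp
    then have "Suc (card (carrier G)) \<le> card (carrier G)"
      using card_mono[OF fin sub] le_trans by blast
    then show False by simp
  qed
  then show ?thesis unfolding sx_def by (rule LeastI_ex)
qed

section \<open>Groups of exponent two\<close>

text \<open>Such a group is abelian, so each nontrivial \<open>x\<close> spans a normal subgroup
  \<open>{\<one>, x}\<close> of order two, which is necessarily minimal. Hence every element lies in
  the socle.\<close>

lemma (in group) socle_exponent_two: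
  assumes sq: "\<And>x. x \<in> carrier G \<Longrightarrow> x \<otimes> x = \<one>"
  shows "socle G = carrier G"
proof
  show "socle G \<subseteq> carrier G"
    using normal_imp_subgroup[OF normal_socle] subgroup.subset by blast
next
  have inv_eq: "inv x = x" if "x \<in> carrier G" for x
    using that sq inv_equality by blast
  have comm: "x \<otimes> y = y \<otimes> x" if "x \<in> carrier G" "y \<in> carrier G" for x y
    using inv_eq inv_mult_group m_closed that by metis
  show "carrier G \<subseteq> socle G"
  proof
    fix x assume x: "x \<in> carrier G"
    show "x \<in> socle G"
    proof (cases "x = \<one>")
      case True
      then show ?thesis by (simp add: socle_def generate.one)
    next
      case False
      have "subgroup {\<one>, x} G"
        using x sq inv_eq by unfold_locales auto
      moreover have "g \<otimes> h \<otimes> inv g \<in> {\<one>, x}" if "g \<in> carrier G" "h \<in> {\<one>, x}" for g h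
        using that x comm[of g h] by (auto simp: m_assoc)
      ultimately have "{\<one>, x} \<lhd> G" by (simp add: normal_inv_iff)
      moreover have "K = {\<one>} \<or> K = {\<one>, x}" if "K \<lhd> G" "K \<subseteq> {\<one>, x}" for K
        using that subgroup.one_closed[OF normal_imp_subgroup] by blast
      ultimately have "minimal_normal G {\<one>, x}"
        using False by (auto simp: minimal_normal_def)
      then show ?thesis unfolding socle_def by (intro generate.incl) auto
    qed
  qed
qed

lemma (in normal) FactGroup_exponent_two:
  assumes "\<And>x. x \<in> carrier G \<Longrightarrow> x \<otimes> x \<in> H" and "X \<in> carrier (G Mod H)"
  shows "X \<otimes>\<^bsub>G Mod H\<^esub> X = \<one>\<^bsub>G Mod H\<^esub>"
  using assms by (auto simp: carrier_FactGroup rcos_sum rcos_const[OF is_group])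

text \<open>The first socle term is formed in \<open>G Mod {\<one>}\<close> rather than in
  \<open>G\<close>, so the exponent is first passed to that quotient. Equality fails for the trivial
  group, whose socle length is 0.\<close>

lemma (in group) sx_exponent_two:
  assumes sq: "\<And>x. x \<in> carrier G \<Longrightarrow> x \<otimes> x = \<one>"
  shows "sx G \<le> 1"
proof -
  interpret T: normal "{\<one>}" G by (rule one_is_normal)
  interpret Q: group "G Mod {\<one>}" by (rule T.factorgroup_is_group)
  have "socle (G Mod {\<one>}) = carrier (G Mod {\<one>})"
    using sq by (intro Q.socle_exponent_two T.FactGroup_exponent_two) auto
  then have "socle_series G 1 = carrier G"
    by (auto simp: carrier_FactGroup)
  then show ?thesis unfolding sx_def by (rule Least_le)
qed

section \<open>Nilpotency class and socle length\<close>

text \<open>These are the n-fold right-normed commutators, which generate the n-th term of the lower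
  central series when \<open>G\<close> itself is counted as term 0. Taking no generated subgroup
  suffices for testing triviality: the set lies in \<open>{\<one>}\<close> exactly when the
  nilpotency class is at most n.\<close>

primrec iterated_comms :: "('a, 'b) monoid_scheme \<Rightarrow> nat \<Rightarrow> 'a set" where
  "iterated_comms G 0 = carrier G"
| "iterated_comms G (Suc n) =
     {g \<otimes>\<^bsub>G\<^esub> x \<otimes>\<^bsub>G\<^esub> inv\<^bsub>G\<^esub> g \<otimes>\<^bsub>G\<^esub> inv\<^bsub>G\<^esub> x | g x. g \<in> carrier G \<and> x \<in> iterated_comms G n}"

lemma (in group) iterated_comms_closed: "iterated_comms G n \<subseteq> carrier G"
  by (induction n) auto

lemma (in group) comm_eq_one_iff:
  assumes "g \<in> carrier G" "x \<in> carrier G"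
  shows "g \<otimes> x \<otimes> inv g \<otimes> inv x = \<one> \<longleftrightarrow> g \<otimes> x = x \<otimes> g"
proof -
  have "g \<otimes> x \<otimes> inv g \<otimes> inv x = (g \<otimes> x) \<otimes> inv (x \<otimes> g)"
    using assms by (simp add: inv_mult_group m_assoc)
  moreover have "\<one> = (g \<otimes> x) \<otimes> inv (x \<otimes> g) \<longleftrightarrow> g \<otimes> x = \<one> \<otimes> (x \<otimes> g)"
    using assms by (intro inv_solve_right) auto
  moreover have "\<one> \<otimes> (x \<otimes> g) = x \<otimes> g" using assms by simp
  ultimately show ?thesis by metis
qed

text \<open>Homomorphisms preserve commutators, and surjectivity lets both entries be lifted. This
  moves nilpotency to quotients and both ways along isomorphisms.\<close>

lemma (in group) iterated_comms_hom_image: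
  assumes H: "group H" and h: "h \<in> hom G H" and surj: "h ` carrier G = carrier H"
  shows "h ` iterated_comms G n = iterated_comms H n"
proof (induction n)
  case 0
  show ?case by (simp add: surj)
next
  case (Suc n)
  interpret h: group_hom G H h
    using H h is_group by (simp add: group_hom_def group_hom_axioms_def)
  have eq: "h (g \<otimes> x \<otimes> inv g \<otimes> inv x) =
      h g \<otimes>\<^bsub>H\<^esub> h x \<otimes>\<^bsub>H\<^esub> inv\<^bsub>H\<^esub> (h g) \<otimes>\<^bsub>H\<^esub> inv\<^bsub>H\<^esub> (h x)"
    if "g \<in> carrier G" "x \<in> iterated_comms G n" for g x
    using that iterated_comms_closed[of n] by (auto simp: subset_iff)
  show ?case
  proof (intro equalityI subsetI)
    fix y assume "y \<in> h ` iterated_comms G (Suc n)"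
    then obtain g x where "g \<in> carrier G" "x \<in> iterated_comms G n"
      "y = h (g \<otimes> x \<otimes> inv g \<otimes> inv x)" by auto
    moreover from this have "h g \<in> carrier H" "h x \<in> iterated_comms H n"
      using surj Suc by auto
    ultimately show "y \<in> iterated_comms H (Suc n)"
      unfolding iterated_comms.simps using eq by blast
  next
    fix y assume "y \<in> iterated_comms H (Suc n)"
    then obtain g' x' where g': "g' \<in> h ` carrier G" and x': "x' \<in> h ` iterated_comms G n"
      and y: "y = g' \<otimes>\<^bsub>H\<^esub> x' \<otimes>\<^bsub>H\<^esub> inv\<^bsub>H\<^esub> g' \<otimes>\<^bsub>H\<^esub> inv\<^bsub>H\<^esub> x'"
      using surj Suc by auto
    from g' x' obtain g x where gx: "g \<in> carrier G" "x \<in> iterated_comms G n" "g' = h g" "x' = h x"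
      by auto
    then have "y = h (g \<otimes> x \<otimes> inv g \<otimes> inv x)" using y eq by simp
    then show "y \<in> h ` iterated_comms G (Suc n)" using gx by auto
  qed
qed

section \<open>The centre, and why the socle of a nilpotent group lies in it\<close>

definition centre :: "('a, 'b) monoid_scheme \<Rightarrow> 'a set" where
  "centre G = {x \<in> carrier G. \<forall>g\<in>carrier G. g \<otimes>\<^bsub>G\<^esub> x = x \<otimes>\<^bsub>G\<^esub> g}"

lemma centre_carrier: "x \<in> centre G \<Longrightarrow> x \<in> carrier G"
  by (simp add: centre_def)

lemma centre_commutes: "x \<in> centre G \<Longrightarrow> g \<in> carrier G \<Longrightarrow> g \<otimes>\<^bsub>G\<^esub> x = x \<otimes>\<^bsub>G\<^esub> g"
  by (simp add: centre_def)

lemma (in group) centre_subgroup: "subgroup (centre G) G"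
proof
  fix x y assume x: "x \<in> centre G" and y: "y \<in> centre G"
  note c = centre_carrier[OF x] centre_carrier[OF y]
  have "g \<otimes> (x \<otimes> y) = x \<otimes> y \<otimes> g" if g: "g \<in> carrier G" for g
  proof -
    have "g \<otimes> (x \<otimes> y) = (g \<otimes> x) \<otimes> y" using c g by (simp add: m_assoc)
    also have "\<dots> = (x \<otimes> g) \<otimes> y" using centre_commutes[OF x g] by (rule arg_cong)
    also have "\<dots> = x \<otimes> (g \<otimes> y)" using c g by (simp add: m_assoc)
    also have "\<dots> = x \<otimes> (y \<otimes> g)" using centre_commutes[OF y g] by (rule arg_cong)
    also have "\<dots> = x \<otimes> y \<otimes> g" using c g by (simp add: m_assoc)
    finally show ?thesis .
  qed
  then show "x \<otimes> y \<in> centre G" using c by (simp add: centre_def)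
next
  fix x assume x: "x \<in> centre G"
  note c = centre_carrier[OF x]
  have "g \<otimes> inv x = inv x \<otimes> g" if g: "g \<in> carrier G" for g
  proof -
    have "g \<otimes> inv x = inv x \<otimes> (x \<otimes> g) \<otimes> inv x"
      using c g by (simp flip: m_assoc)
    also have "\<dots> = inv x \<otimes> (g \<otimes> x) \<otimes> inv x"
      using centre_commutes[OF x g] by (rule arg_cong[OF sym])
    also have "\<dots> = inv x \<otimes> g" using c g by (simp add: m_assoc)
    finally show ?thesis .
  qed
  then show "inv x \<in> centre G" using c by (simp add: centre_def)
qed (auto simp: centre_def)

text \<open>At the last commutator depth where \<open>M\<close> still has a nontrivial element
  \<open>z\<close>, the commutators of \<open>z\<close> lie in \<open>M\<close> and one level
  deeper, so they vanish and \<open>z\<close> is central. Thus \<open>M\<close> meets the centre in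
  a nontrivial normal subgroup, which is all of \<open>M\<close> by minimality.\<close>

lemma (in group) minimal_normal_central:
  assumes nil: "iterated_comms G c \<subseteq> {\<one>}" and M: "minimal_normal G M"
  shows "M \<subseteq> centre G"
proof -
  interpret M: normal M G using M by (simp add: minimal_normal_def)
  have M1: "M \<noteq> {\<one>}" using M by (simp add: minimal_normal_def)
  define n where "n = (LEAST n. M \<inter> iterated_comms G n \<subseteq> {\<one>})"
  have n: "M \<inter> iterated_comms G n \<subseteq> {\<one>}"
    unfolding n_def by (rule LeastI[of _ c]) (use nil in auto)
  \<comment> \<open>At depth 0 the intersection is \<open>M\<close> itself.\<close>
  have "n \<noteq> 0" using n M1 M.subset M.one_closed by auto
  then obtain m where m: "n = Suc m" by (cases n) auto
  then have "\<not> M \<inter> iterated_comms G m \<subseteq> {\<one>}"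
    using not_less_Least[of m "\<lambda>n. M \<inter> iterated_comms G n \<subseteq> {\<one>}"] by (simp add: n_def)
  then obtain z where z: "z \<in> M" "z \<in> iterated_comms G m" "z \<noteq> \<one>" by auto
  have "g \<otimes> z = z \<otimes> g" if g: "g \<in> carrier G" for g
  proof -
    have "g \<otimes> z \<otimes> inv g \<otimes> inv z \<in> M"
      using z(1) g M.inv_op_closed2 by auto
    moreover have "g \<otimes> z \<otimes> inv g \<otimes> inv z \<in> iterated_comms G n"
      using z(2) g m by auto
    ultimately show ?thesis using n comm_eq_one_iff[OF g M.mem_carrier[OF z(1)]] by blast
  qed
  then have zZ: "z \<in> M \<inter> centre G" using z(1) M.mem_carrier unfolding centre_def by blast
  have "g \<otimes> h \<otimes> inv g = h" if "g \<in> carrier G" "h \<in> centre G" for g h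
    using that centre_carrier centre_commutes by (metis inv_closed m_assoc r_inv r_one)
  then have "M \<inter> centre G \<lhd> G"
    using subgroups_Inter_pair[OF M.subgroup_axioms centre_subgroup]
    by (auto simp: normal_inv_iff)
  moreover have "M \<inter> centre G \<noteq> {\<one>}" using zZ z(3) by auto
  ultimately show ?thesis using M unfolding minimal_normal_def by blast
qed

lemma (in group) socle_central:
  assumes "iterated_comms G c \<subseteq> {\<one>}"
  shows "socle G \<subseteq> centre G"
  unfolding socle_def
  using minimal_normal_central[OF assms] centre_subgroup by (intro generate_subgroup_incl) auto

text \<open>This says that the socle series is central: the quotient by the i-th term is again
  nilpotent, so its socle is central, and cosets that commute have their commutator in the i-th
  term.\<close>

lemma (in group) comm_socle_series:
  assumes nil: "iterated_comms G c \<subseteq> {\<one>}"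
    and g: "g \<in> carrier G" and x: "x \<in> socle_series G (Suc i)"
  shows "g \<otimes> x \<otimes> inv g \<otimes> inv x \<in> socle_series G i"
proof -
  let ?V = "socle_series G i"
  interpret V: normal ?V G by (rule normal_socle_series)
  interpret Q: group "G Mod ?V" by (rule V.factorgroup_is_group)
  interpret p: group_hom G "G Mod ?V" "\<lambda>a. ?V #> a"
    using V.r_coset_hom_Mod by unfold_locales
  have "iterated_comms (G Mod ?V) c = (\<lambda>a. ?V #> a) ` iterated_comms G c"
    using iterated_comms_hom_image[OF Q.is_group V.r_coset_hom_Mod, of c]
    by (simp add: carrier_FactGroup)
  also have "\<dots> \<subseteq> {\<one>\<^bsub>G Mod ?V\<^esub>}" using nil p.hom_one by blast
  finally have "socle (G Mod ?V) \<subseteq> centre (G Mod ?V)" by (rule Q.socle_central)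
  with x have xG: "x \<in> carrier G" and Vx: "?V #> x \<in> centre (G Mod ?V)" by auto
  have eq: "(?V #> g) \<otimes>\<^bsub>G Mod ?V\<^esub> (?V #> x) = (?V #> x) \<otimes>\<^bsub>G Mod ?V\<^esub> (?V #> g)"
    by (rule centre_commutes[OF Vx p.hom_closed[OF g]])
  have "?V #> (g \<otimes> x) = ?V #> (x \<otimes> g)"
    using eq unfolding p.hom_mult[OF g xG, symmetric] p.hom_mult[OF xG g, symmetric] .
  then have "g \<otimes> x \<in> ?V #> (x \<otimes> g)"
    using rcos_self[of "g \<otimes> x" ?V] g xG V.subgroup_axioms by auto
  then have "g \<otimes> x \<otimes> inv (x \<otimes> g) \<in> ?V"
    using V.rcos_module_imp[OF is_group] g xG by auto
  then show ?thesis using g xG by (simp add: inv_mult_group m_assoc)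
qed

text \<open>The bound \<open>c\<close> only expresses that \<open>G\<close> is nilpotent; the
  conclusion replaces it by the socle length.\<close>

theorem (in group) nilpotency_class_le_sx:
  assumes fin: "finite (carrier G)" and nil: "iterated_comms G c \<subseteq> {\<one>}"
  shows "iterated_comms G (sx G) \<subseteq> {\<one>}"
proof -
  \<comment> \<open>Starting from the top term \<open>G\<close>, each further commutator descends
    one term. The bound on \<open>i\<close> keeps the subtraction from being truncated.\<close>
  have "i \<le> sx G \<Longrightarrow> iterated_comms G i \<subseteq> socle_series G (sx G - i)" for i
  proof (induction i)
    case 0
    then show ?case by (simp add: socle_series_sx[OF fin])
  next
    case (Suc i)
    then have "iterated_comms G i \<subseteq> socle_series G (Suc (sx G - Suc i))"
      by (metis Suc_diff_Suc Suc_leD Suc_le_lessD)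
    then show ?case
      using comm_socle_series[OF nil] by fastforce
  qed
  from this[of "sx G"] show ?thesis by simp
qed

section \<open>Complexity functions on elementary abelian 2-groups\<close>

text \<open>The structure is transported along a bijection onto an initial segment of the naturals.
  The complexity axioms speak only about groups on that type.\<close>

lemma finite_group_nat_copy:
  assumes "finite_group H"
  obtains P :: "nat monoid" where "finite_group P" "P \<cong> H"
proof -
  interpret H: group H using assms by (simp add: finite_group_def)
  obtain e where e: "bij_betw e (carrier H) {0..<card (carrier H)}"
    using ex_bij_betw_finite_nat assms unfolding finite_group_def by blast
  define d where "d = inv_into (carrier H) e"
  define P :: "nat monoid" where
    "P = \<lparr>carrier = {0..<card (carrier H)}, mult = \<lambda>x y. e (d x \<otimes>\<^bsub>H\<^esub> d y), one = e \<one>\<^bsub>H\<^esub>\<rparr>"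
  have "d (e x) = x" if "x \<in> carrier H" for x
    using e that by (simp add: d_def bij_betw_def)
  then have "e \<in> iso H P"
    using e by (auto simp: iso_def hom_def P_def bij_betw_def)
  moreover have "carrier P = e ` carrier H"
    using e by (simp add: P_def bij_betw_def)
  then have "P\<lparr>carrier := e ` carrier H, one := e \<one>\<^bsub>H\<^esub>\<rparr> = P" by (simp add: P_def)
  ultimately have "group P" "P \<cong> H"
    using H.hom_imp_img_group[of e P] H.iso_sym is_isoI iso_imp_homomorphism by fastforce+
  moreover have "finite (carrier P)" by (simp add: P_def)
  ultimately show ?thesis using that unfolding finite_group_def by blast
qed

lemma complexity_iso_le:
  assumes "complexity_function c" "finite_group G" "finite_group H" "G \<cong> H"
  shows "c H \<le> c G"
proof -
  have "epi G H \<noteq> {}" using assms(4) by (auto simp: is_iso_def iso_iff_mon_epi)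
  then show ?thesis using assms by (auto simp: complexity_function_def quotient_axiom_def)
qed

text \<open>Since \<open>c\<close> accepts only groups on the naturals, a bound for a group on
  another type is expressed through all its copies there.\<close>

definition complexity_le_one :: "(nat monoid \<Rightarrow> nat) \<Rightarrow> ('a, 'b) monoid_scheme \<Rightarrow> bool" where
  "complexity_le_one c H \<longleftrightarrow> (\<forall>G. finite_group G \<and> G \<cong> H \<longrightarrow> c G \<le> 1)"

lemma complexity_le_one_DirProd:
  assumes c: "complexity_function c" and H: "finite_group H" "complexity_le_one c H"
    and K: "finite_group K" "complexity_le_one c K"
  shows "complexity_le_one c (H \<times>\<times> K)"
  unfolding complexity_le_one_def
proof (intro allI impI)
  fix G :: "nat monoid" assume G: "finite_group G \<and> G \<cong> H \<times>\<times> K"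
  obtain P :: "nat monoid" where P: "finite_group P" "P \<cong> H" by (rule finite_group_nat_copy[OF H(1)])
  obtain Q :: "nat monoid" where Q: "finite_group Q" "Q \<cong> K" by (rule finite_group_nat_copy[OF K(1)])
  have "P \<times>\<times> Q \<cong> H \<times>\<times> K"
    using P Q H K by (auto simp: finite_group_def intro: group.DirProd_iso_trans)
  then have "G \<cong> P \<times>\<times> Q"
    using G P Q by (meson DirProd_group finite_group_def group.iso_sym iso_trans)
  then have "c G = max (c P) (c Q)"
    using c G P Q by (auto simp: complexity_function_def product_axiom_def)
  then show "c G \<le> 1"
    using H(2) K(2) P Q by (auto simp: complexity_le_one_def)
qed

text \<open>In a series given by constructability, the first term different from \<open>G\<close> is
  normal in \<open>G\<close>, hence trivial. The corresponding factor is then \<open>G\<close>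
  itself, and it has complexity at most 1.\<close>

lemma complexity_le_one_simple:
  fixes G :: "nat monoid"
  assumes c: "complexity_function c" and G: "finite_group G"
    and simple: "\<And>K. K \<lhd> G \<Longrightarrow> K = {\<one>\<^bsub>G\<^esub>} \<or> K = carrier G"
  shows "c G \<le> 1"
proof (cases "trivial_group G")
  case True
  then show ?thesis using c by (simp add: complexity_function_def initial_condition_def)
next
  case False
  interpret G: group G using G by (simp add: finite_group_def)
  obtain n S where S: "S 0 = carrier G" "S n = {\<one>\<^bsub>G\<^esub>}"
    and step: "\<And>i. i < n \<Longrightarrow> S (Suc i) \<lhd> G\<lparr>carrier := S i\<rparr> \<and>
      (\<exists>Q. finite_group Q \<and> Q \<cong> G\<lparr>carrier := S i\<rparr> Mod S (Suc i) \<and> c Q \<le> 1)"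
    using c G unfolding complexity_function_def constructability_axiom_def by metis
  have nt: "carrier G \<noteq> {\<one>\<^bsub>G\<^esub>}" using False G.is_group by (simp add: trivial_group_def)
  \<comment> \<open>The series may repeat \<open>G\<close> at its start, so the index at which it
    first leaves \<open>G\<close> is singled out.\<close>
  define m where "m = (LEAST m. S m \<noteq> carrier G)"
  have Sm: "S m \<noteq> carrier G" unfolding m_def by (rule LeastI[of _ n]) (use S(2) nt in auto)
  have "m \<le> n" unfolding m_def by (rule Least_le) (use S(2) nt in auto)
  moreover obtain i where i: "m = Suc i" using Sm S(1) by (cases m) auto
  moreover have Si: "S i = carrier G" using i not_less_Least[of i "\<lambda>m. S m \<noteq> carrier G"] by (simp add: m_def)
  ultimately have Q: "S m \<lhd> G" "\<exists>Q. finite_group Q \<and> Q \<cong> G Mod S m \<and> c Q \<le> 1"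
    using step[of i] i Si by auto
  moreover have "S m = {\<one>\<^bsub>G\<^esub>}" using simple[OF Q(1)] Sm by simp
  ultimately obtain Q where Q: "finite_group Q" "Q \<cong> G Mod {\<one>\<^bsub>G\<^esub>}" "c Q \<le> 1" by auto
  then have "Q \<cong> G" using iso_trans[OF Q(2) is_isoI[OF G.trivial_factor_iso]] by simp
  then show ?thesis using complexity_iso_le[OF c Q(1) G] Q(3) by simp
qed

lemma complexity_le_one_card_two:
  assumes c: "complexity_function c" and card: "card (carrier H) = 2"
  shows "complexity_le_one c H"
  unfolding complexity_le_one_def
proof (intro allI impI)
  fix G :: "nat monoid" assume G: "finite_group G \<and> G \<cong> H"
  interpret G: group G using G by (simp add: finite_group_def)
  have two: "card (carrier G) = 2" using G card iso_same_card by metis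
  have "K = {\<one>\<^bsub>G\<^esub>} \<or> K = carrier G" if "K \<lhd> G" for K
  proof -
    interpret K: normal K G by (rule that)
    obtain a b where ab: "carrier G = {a, b}" using two by (auto simp: card_2_iff)
    then show ?thesis using K.subset K.one_closed G.one_closed by auto
  qed
  then show "c G \<le> 1" using complexity_le_one_simple[OF c] G by blast
qed

section \<open>Unitriangular 4 by 4 matrices\<close>

text \<open>
  The tuple \<open>(a, b, c, d, e, f)\<close> stands for the matrix with first row \<open>1 a d f\<close>, second row
  \<open>0 1 b e\<close>, third row \<open>0 0 1 c\<close> and fourth row \<open>0 0 0 1\<close>.
\<close>

type_synonym 'r entries = "'r \<times> 'r \<times> 'r \<times> 'r \<times> 'r \<times> 'r"

definition unitri :: "'r::comm_ring_1 entries monoid" where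
  "unitri = \<lparr>carrier = UNIV,
     mult = \<lambda>(a, b, c, d, e, f) (a', b', c', d', e', f').
       (a + a', b + b', c + c', d + d' + a * b', e + e' + b * c', f + f' + a * e' + d * c'),
     one = (0, 0, 0, 0, 0, 0)\<rparr>"

lemma carrier_unitri [simp]: "carrier unitri = UNIV"
  by (simp add: unitri_def)

lemma one_unitri [simp]: "\<one>\<^bsub>unitri\<^esub> = (0, 0, 0, 0, 0, 0)"
  by (simp add: unitri_def)

lemma mult_unitri [simp]:
  "(a, b, c, d, e, f) \<otimes>\<^bsub>unitri\<^esub> (a', b', c', d', e', f') =
     (a + a', b + b', c + c', d + d' + a * b', e + e' + b * c', f + f' + a * e' + d * c')"
  by (simp add: unitri_def)

lemma group_unitri: "group unitri"
proof (rule groupI)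
  fix x y z :: "'a::comm_ring_1 entries"
  show "x \<otimes>\<^bsub>unitri\<^esub> y \<otimes>\<^bsub>unitri\<^esub> z = x \<otimes>\<^bsub>unitri\<^esub> (y \<otimes>\<^bsub>unitri\<^esub> z)"
    by (cases x; cases y; cases z) (simp add: algebra_simps)
  show "\<one>\<^bsub>unitri\<^esub> \<otimes>\<^bsub>unitri\<^esub> x = x" by (cases x) simp
  obtain a b c d e f where x: "x = (a, b, c, d, e, f)" by (cases x)
  \<comment> \<open>For x = 1 + n with n strictly upper triangular, this is the finite geometric
    series 1 - n + n^2 - n^3.\<close>
  have "(- a, - b, - c, a * b - d, b * c - e, a * e + d * c - f - a * b * c) \<otimes>\<^bsub>unitri\<^esub> x = \<one>\<^bsub>unitri\<^esub>"
    by (simp add: x algebra_simps)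
  then show "\<exists>y\<in>carrier unitri. y \<otimes>\<^bsub>unitri\<^esub> x = \<one>\<^bsub>unitri\<^esub>"
    by (intro bexI) auto
qed auto

lemma inv_unitri [simp]:
  "inv\<^bsub>unitri\<^esub> (a, b, c, d, e, f) =
     (- a, - b, - c, a * b - d, b * c - e, a * e + d * c - f - a * b * c)"
  by (rule group.inv_equality[OF group_unitri]) (simp_all add: algebra_simps)

text \<open>Each commutator clears one more diagonal: the first clears the superdiagonal, the second
  leaves only the corner entry \<open>f\<close>, and matrices of that shape are central.\<close>

lemma iterated_comms_unitri_3:
  "iterated_comms (unitri :: 'a::comm_ring_1 entries monoid) 3 \<subseteq> {\<one>\<^bsub>unitri\<^esub>}"
proof -
  have "iterated_comms (unitri :: 'a entries monoid) 1 \<subseteq> {(a, b, c, d, e, f). a = 0 \<and> b = 0 \<and> c = 0}"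
    by auto
  then have "iterated_comms (unitri :: 'a entries monoid) 2 \<subseteq> {(a, b, c, d, e, f). a = 0 \<and> b = 0 \<and> c = 0 \<and> d = 0 \<and> e = 0}"
    unfolding numeral_2_eq_2 One_nat_def iterated_comms.simps(2)[of _ "Suc 0"] by fastforce
  then have two: "x \<in> iterated_comms unitri 2 \<Longrightarrow> \<exists>f. x = (0, 0, 0, 0, 0, f)" for x :: "'a entries"
    by (cases x) blast
  have "g \<otimes>\<^bsub>unitri\<^esub> x \<otimes>\<^bsub>unitri\<^esub> inv\<^bsub>unitri\<^esub> g \<otimes>\<^bsub>unitri\<^esub> inv\<^bsub>unitri\<^esub> x = \<one>\<^bsub>unitri\<^esub>"
    if "x \<in> iterated_comms unitri 2" for g x :: "'a entries"
    using two[OF that] by (cases g) (auto simp: algebra_simps)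
  moreover have "3 = Suc 2" by simp
  ultimately show ?thesis by (auto simp only: iterated_comms.simps)
qed

text \<open>Writing Eij for the matrix with an extra 1 at (i, j), the witnesses are [E23, E34] = E24
  and [E12, E24] = E14.\<close>

lemma iterated_comms_unitri_2:
  "\<not> iterated_comms (unitri :: 'r::comm_ring_1 entries monoid) 2 \<subseteq> {\<one>\<^bsub>unitri\<^esub>}"
proof -
  let ?U = "unitri :: 'r entries monoid"
  have comm: "g \<otimes>\<^bsub>?U\<^esub> x \<otimes>\<^bsub>?U\<^esub> inv\<^bsub>?U\<^esub> g \<otimes>\<^bsub>?U\<^esub> inv\<^bsub>?U\<^esub> x \<in> iterated_comms ?U (Suc n)"
    if "x \<in> iterated_comms ?U n" for g x n
    using that by (simp only: iterated_comms.simps mem_Collect_eq carrier_unitri) blast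
  have "(0, 0, 0, 0, 1, 0) \<in> iterated_comms ?U (Suc 0)"
    using comm[of "(0, 0, 1, 0, 0, 0)" 0 "(0, 1, 0, 0, 0, 0)"] by simp
  then have "(0, 0, 0, 0, 0, 1) \<in> iterated_comms ?U 2"
    using comm[of "(0, 0, 0, 0, 1, 0)" "Suc 0" "(1, 0, 0, 0, 0, 0)"]
    by (simp add: numeral_2_eq_2 del: iterated_comms.simps)
  then show ?thesis by auto
qed

section \<open>The abelian quotient and the abelian kernel of the unitriangular group\<close>

definition additive :: "'r::ab_group_add monoid" where
  "additive = \<lparr>carrier = UNIV, mult = (+), one = 0\<rparr>"

lemma group_additive: "group additive"
  by (rule groupI) (auto simp: additive_def algebra_simps intro: exI[of _ "- x" for x])

abbreviation plane :: "('r::ab_group_add \<times> 'r) monoid" where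
  "plane \<equiv> additive \<times>\<times> additive"

lemma group_plane: "group plane"
  by (intro DirProd_group group_additive)

text \<open>
  Only the two entries of the superdiagonal that lie in the diagonal 2 by 2 blocks are kept, so that
  the kernel is the abelian subgroup of matrices supported in the upper right block.
\<close>

definition superdiagonal :: "'r entries \<Rightarrow> 'r \<times> 'r" where
  "superdiagonal = (\<lambda>(a, b, c, d, e, f). (a, c))"

lemma superdiagonal_epi: "superdiagonal \<in> epi unitri plane"
proof -
  have "(a, c) \<in> range superdiagonal" for a c :: 'r
    by (rule range_eqI[where x = "(a, a, c, a, a, a)"]) (simp add: superdiagonal_def)
  then show ?thesis by (auto simp: epi_def hom_def superdiagonal_def additive_def)
qed

text \<open>On the kernel \<open>a\<close> and \<open>c\<close> vanish, which kills every product
  term in the multiplication and leaves entrywise addition of \<open>b\<close>, \<open>d\<close>,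
  \<open>e\<close>, \<open>f\<close>.\<close>

lemma kernel_superdiagonal_iso:
  "(unitri :: 'r::comm_ring_1 entries monoid)\<lparr>carrier := kernel unitri plane superdiagonal\<rparr> \<cong>
     (plane \<times>\<times> plane :: (('r \<times> 'r) \<times> ('r \<times> 'r)) monoid)"
  (is "?K \<cong> ?P")
proof -
  let ?h = "\<lambda>(a, b, c, d, e, f). ((b, d), (e, f))"
  have "?h \<in> hom ?K ?P"
    by (auto simp: hom_def kernel_def superdiagonal_def additive_def)
  moreover have "bij_betw ?h (carrier ?K) (carrier ?P)"
    by (rule bij_betw_byWitness[where f' = "\<lambda>((b, d), (e, f)). (0, b, 0, d, e, f)"])
      (auto simp: kernel_def superdiagonal_def additive_def)
  ultimately show ?thesis by (intro is_isoI isoI)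
qed

section \<open>The counterexample\<close>

lemma UNIV_bit: "(UNIV :: bit set) = {0, 1}"
  by auto

lemma finite_UNIV_bit [simp]: "finite (UNIV :: bit set)"
  unfolding UNIV_bit by simp

lemma card_UNIV_bit: "card (UNIV :: bit set) = 2"
  unfolding UNIV_bit by simp

lemma finite_unitri_bit: "finite_group (unitri :: bit entries monoid)"
  using group_unitri by (simp add: finite_group_def flip: UNIV_Times_UNIV)

lemma finite_additive_bit: "finite_group (additive :: bit monoid)"
  by (simp add: finite_group_def group_additive) (simp add: additive_def)

lemma finite_plane_bit: "finite_group (plane :: (bit \<times> bit) monoid)"
  using finite_additive_bit group_plane by (simp add: finite_group_def)

text \<open>The product axiom takes a maximum, so the bound 1 for order two persists for the
  elementary abelian groups of orders 4 and 16.\<close>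

lemma complexity_le_one_plane_bit:
  assumes c: "complexity_function c"
  shows "complexity_le_one c (plane :: (bit \<times> bit) monoid)"
    and "complexity_le_one c (plane \<times>\<times> plane :: ((bit \<times> bit) \<times> (bit \<times> bit)) monoid)"
proof -
  have "complexity_le_one c (additive :: bit monoid)"
    by (rule complexity_le_one_card_two[OF c]) (simp add: additive_def card_UNIV_bit)
  then show *: "complexity_le_one c (plane :: (bit \<times> bit) monoid)"
    by (intro complexity_le_one_DirProd c finite_additive_bit)
  show "complexity_le_one c (plane \<times>\<times> plane :: ((bit \<times> bit) \<times> (bit \<times> bit)) monoid)"
    by (intro complexity_le_one_DirProd c finite_plane_bit *)
qed

text \<open>Pulling the exponent back to \<open>G\<close> avoids a proof that \<open>sx\<close> is
  invariant under isomorphism.\<close>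

lemma sx_iso_exponent_two:
  assumes G: "group G" and H: "group H" and iso: "G \<cong> H"
    and sq: "\<And>x. x \<in> carrier H \<Longrightarrow> x \<otimes>\<^bsub>H\<^esub> x = \<one>\<^bsub>H\<^esub>"
  shows "sx G \<le> 1"
proof (rule group.sx_exponent_two[OF G])
  fix x assume x: "x \<in> carrier G"
  obtain h where h: "h \<in> iso G H" using iso by (auto simp: is_iso_def)
  interpret h: group_hom G H h
    using G H h by (simp add: group_hom_def group_hom_axioms_def iso_iff)
  have "h (x \<otimes>\<^bsub>G\<^esub> x) = h \<one>\<^bsub>G\<^esub>" using x sq by simp
  then show "x \<otimes>\<^bsub>G\<^esub> x = \<one>\<^bsub>G\<^esub>"
    using h x by (auto simp: iso_iff inj_on_def)
qed

lemma sx_plane_bit: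
  assumes "group G" "G \<cong> (plane :: (bit \<times> bit) monoid)"
  shows "sx G \<le> 1"
  by (rule sx_iso_exponent_two[OF assms(1) group_plane assms(2)]) (auto simp: additive_def)

lemma sx_plane_plane_bit:
  assumes "group G" "G \<cong> (plane \<times>\<times> plane :: ((bit \<times> bit) \<times> (bit \<times> bit)) monoid)"
  shows "sx G \<le> 1"
  by (rule sx_iso_exponent_two[OF assms(1) DirProd_group[OF group_plane group_plane] assms(2)])
    (auto simp: additive_def)

text \<open>Here too only the iterated commutators are transported: vanishing at depth 3 is pulled
  back to \<open>G\<close> to make it nilpotent, and a socle length of at most 2 would force
  vanishing at depth 2 in the matrix group.\<close>

lemma sx_unitri_copy:
  fixes G :: "'a monoid"
  assumes G: "finite_group G"
    and iso: "G \<cong> (unitri :: 'r::comm_ring_1 entries monoid)"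
  shows "sx G > 2"
proof (rule ccontr)
  let ?U = "unitri :: 'r entries monoid"
  interpret G: group G using G by (simp add: finite_group_def)
  obtain h where h: "h \<in> iso G ?U" using iso by (auto simp: is_iso_def)
  interpret h: group_hom G ?U h
    using h group_unitri by (simp add: group_hom_def group_hom_axioms_def iso_iff)
  have image: "h ` iterated_comms G n = iterated_comms ?U n" for n
    using h by (intro G.iterated_comms_hom_image group_unitri) (auto simp: iso_iff)
  have "x = \<one>\<^bsub>G\<^esub>" if "x \<in> iterated_comms G 3" for x
  proof -
    have "h x \<in> iterated_comms ?U 3" unfolding image[symmetric] using that by (rule imageI)
    then have "h x = h \<one>\<^bsub>G\<^esub>"
      using subsetD[OF iterated_comms_unitri_3] unfolding h.hom_one by blast
    moreover have "x \<in> carrier G" using that by (rule subsetD[OF G.iterated_comms_closed])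
    moreover have "inj_on h (carrier G)" using h by (simp add: iso_iff)
    ultimately show ?thesis by (simp add: inj_onD)
  qed
  then have "iterated_comms G (sx G) \<subseteq> {\<one>\<^bsub>G\<^esub>}"
    using G by (intro G.nilpotency_class_le_sx) (auto simp: finite_group_def)
  \<comment> \<open>Commutators with the identity are trivial, so vanishing at depth
    \<open>sx G\<close> passes on to depth 2.\<close>
  moreover have "iterated_comms G (n + k) \<subseteq> {\<one>\<^bsub>G\<^esub>}" if "iterated_comms G n \<subseteq> {\<one>\<^bsub>G\<^esub>}" for n k
    using that by (induction k) auto
  moreover assume "\<not> sx G > 2"
  ultimately have "iterated_comms G 2 \<subseteq> {\<one>\<^bsub>G\<^esub>}"
    by (metis le_add_diff_inverse not_less)
  then have "h ` iterated_comms G 2 \<subseteq> {\<one>\<^bsub>?U\<^esub>}" using h.hom_one by blast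
  then have "iterated_comms ?U 2 \<subseteq> {\<one>\<^bsub>?U\<^esub>}" unfolding image .
  then show False using iterated_comms_unitri_2 by blast
qed

lemma kernel_iso_restrict:
  assumes f: "f \<in> iso G H"
  shows "G\<lparr>carrier := kernel G K (p \<circ> f)\<rparr> \<cong> H\<lparr>carrier := kernel H K p\<rparr>"
proof -
  have "f \<in> hom (G\<lparr>carrier := kernel G K (p \<circ> f)\<rparr>) (H\<lparr>carrier := kernel H K p\<rparr>)"
    using f by (auto simp: iso_iff hom_def kernel_def)
  moreover have "f ` kernel G K (p \<circ> f) = kernel H K p"
    using f by (auto simp: iso_iff hom_def kernel_def image_iff)
  moreover have "inj_on f (kernel G K (p \<circ> f))"
    using f by (auto simp: iso_iff kernel_def intro: inj_on_subset)
  ultimately have "f \<in> iso (G\<lparr>carrier := kernel G K (p \<circ> f)\<rparr>) (H\<lparr>carrier := kernel H K p\<rparr>)"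
    by (intro isoI) (simp_all add: bij_betw_def)
  then show ?thesis by (rule is_isoI)
qed

theorem corollary5p15:
  "\<not> extension_axiom sx \<and>
   (\<exists>(G :: nat monoid) N. finite_group G \<and> N \<lhd> G \<and>
      sx G > sx (G\<lparr>carrier := N\<rparr>) + sx (G Mod N)) \<and>
   (\<exists>G :: nat monoid. finite_group G \<and> cx G \<noteq> sx G)"
proof -
  let ?U = "unitri :: bit entries monoid"
  let ?P = "plane :: (bit \<times> bit) monoid"
  obtain G :: "nat monoid" where G: "finite_group G" and "G \<cong> ?U"
    by (rule finite_group_nat_copy[OF finite_unitri_bit])
  then have sxG: "sx G > 2" by (rule sx_unitri_copy)
  interpret G: group G using G by (simp add: finite_group_def)
  obtain h where h: "h \<in> iso G ?U" using \<open>G \<cong> ?U\<close> by (auto simp: is_iso_def)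
  \<comment> \<open>This is the upper right block subgroup, seen inside the copy
    \<open>G\<close>.\<close>
  define N where "N = kernel G ?P (superdiagonal \<circ> h)"
  have epi: "superdiagonal \<circ> h \<in> epi G ?P"
    using h superdiagonal_epi by (auto simp: iso_iff_mon_epi intro: epi_compose)
  interpret p: group_hom G ?P "superdiagonal \<circ> h"
    using epi group_plane by (simp add: group_hom_def group_hom_axioms_def epi_def)
  have N: "N \<lhd> G" unfolding N_def by (rule p.normal_kernel)
  then interpret N: normal N G .
  have finN: "finite_group (G\<lparr>carrier := N\<rparr>)"
    using G N.subset G.subgroup_imp_group[OF N.subgroup_axioms]
    by (auto simp: finite_group_def intro: finite_subset)
  have finQ: "finite_group (G Mod N)"
    using G N.factorgroup_is_group by (simp add: finite_group_def carrier_FactGroup)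
  have isoN: "G\<lparr>carrier := N\<rparr> \<cong> ?P \<times>\<times> ?P"
    unfolding N_def by (rule iso_trans[OF kernel_iso_restrict[OF h] kernel_superdiagonal_iso])
  have isoQ: "G Mod N \<cong> ?P"
    unfolding N_def using epi by (intro p.FactGroup_iso) (simp add: epi_def)
  have sxN: "sx (G\<lparr>carrier := N\<rparr>) \<le> 1"
    using finN isoN by (intro sx_plane_plane_bit) (auto simp: finite_group_def)
  have sxQ: "sx (G Mod N) \<le> 1"
    using finQ isoQ by (intro sx_plane_bit) (auto simp: finite_group_def)
  \<comment> \<open>The extension axiom needs a copy of the quotient on the naturals, while the
    explicit inequality concerns \<open>G Mod N\<close> itself; the socle length is therefore
    bounded for both.\<close>
  obtain Q :: "nat monoid" where Q: "finite_group Q" "Q \<cong> G Mod N"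
    by (rule finite_group_nat_copy[OF finQ])
  then have isoQP: "Q \<cong> ?P" using isoQ iso_trans by blast
  then have "sx Q \<le> 1" using Q by (intro sx_plane_bit) (auto simp: finite_group_def)
  then have "sx (G\<lparr>carrier := N\<rparr>) + sx Q < sx G" using sxN sxG by linarith
  then have "\<not> extension_axiom sx"
    unfolding extension_axiom_def using G N Q by (meson not_less)
  moreover have "cx G \<noteq> sx G"
  proof -
    have le: "c G \<le> 2" if c: "complexity_function c" for c
    proof -
      have "c G \<le> c (G\<lparr>carrier := N\<rparr>) + c Q"
        using c G N Q unfolding complexity_function_def extension_axiom_def by blast
      moreover have "c (G\<lparr>carrier := N\<rparr>) \<le> 1" "c Q \<le> 1"
        using complexity_le_one_plane_bit[OF c] finN isoN Q isoQP
        by (auto simp: complexity_le_one_def)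
      ultimately show ?thesis by linarith
    qed
    have "cx G \<le> 2"
    proof (cases "{c G | c. complexity_function c} = {}")
      case True
      then show ?thesis unfolding cx_def by (simp only: Sup_nat_empty)
    next
      case False
      then show ?thesis unfolding cx_def using le by (intro cSup_least) auto
    qed
    then show ?thesis using sxG by simp
  qed
  moreover have "sx G > sx (G\<lparr>carrier := N\<rparr>) + sx (G Mod N)"
    using sxN sxQ sxG by linarith
  ultimately show ?thesis using G N by blast
qed

end
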